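(* Let $H\in\mathcal G$ be such that every element $h\in H$, written as $h=\varepsilon_A q$ with $A\in RM(2,4)$ and $q\in Q$, has either $A\in RM(1,4)$ or $A$ of defect $2$, and suppose the orbit $x_0H=\{x_0h:h\in H\}$ has 64 elements. Then: (i) the spherical code $\tfrac14 x_0H$ in $\mathbb{R}^{16}$ has cosine set $\{0,\pm\tfrac14\}$; (ii) the spherical code obtained by orthogonally projecting $x_0H$ onto $v_{\omega_0}^{\perp}$ and rescaling to unit length (in 15 dimensions) has cosine set $\{-\tfrac13,-\tfrac1{15},\tfrac15\}$; (iii) the spherical code obtained by orthogonally projecting $x_0H$ onto $\mathrm{span}\{v_{\omega_0},v_{\omega_1}\}^{\perp}$ and rescaling to unit length (in 14 dimensions) has cosine set $\{-\tfrac37,-\tfrac17,\tfrac17\}$.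
   Context: A spherical code is a finite set of unit vectors; its cosines are the inner products of distinct members. Let $\Omega=\mathbb{F}_2^4$, $V=\mathbb{R}^{16}$ with orthonormal basis $(v_\omega)_{\omega\in\Omega}$, $x_0=\sum_\omega v_\omega$. For $A\subseteq\Omega$, $\varepsilon_A$ is the orthogonal map negating $v_\omega$ for $\omega\in A$ and fixing the other $v_\omega$. Subsets of $\Omega$ are identified with binary words (addition = symmetric difference); $RM(1,4)\subset RM(2,4)$ are the Reed–Muller codes on $\Omega$, $RM(r,4)$ being spanned by affine subspaces of codimension $r$. The defect of $A\in RM(2,4)$: $A$ is the support of a Boolean function $F$ of degree $\le2$ on $\mathbb{F}_2^4$, and the alternating form $B_F(u,w)=F(x+u+w)+F(x+u)+F(x+w)+F(x)$ (independent of $x$) has rank $2k$; $k\in\{0,1,2\}$ is the defect of $A$ (defect $0$ iff $A\in RM(1,4)$). Let $\omega_0=0$, fix $\omega_1\in\Omega\setminus\{0\}$, and fix a linear hyperplane $B_0$ of $\Omega$ with $\omega_1\notin B_0$. Let $Q=\{g\in GL(4,2):\omega_1g=\omega_1,\ B_0g=B_0\}\cong GL(3,2)$, acting on $V$ by permutation matrices $v_\omega\mapsto v_{\omega g}$. Let $E=\{\varepsilon_A:A\in RM(1,4),\ \omega_0,\omega_1\notin A\}\cong2^3$ and $J=\{\varepsilon_A:A\in RM(2,4),\ \omega_0,\omega_1\notin A\}$; $Q$ normalizes $J$ and $E$, and $JQ$ is their semidirect product. Let $\mathcal G$ be the set of subgroups $H$ with $E\le H\le JQ$ and $H/E\cong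 GL(3,2)$. *)

theory Defs
  imports "HOL-Analysis.Analysis" "HOL-Algebra.Coset" "HOL-Library.Z2"
begin

instance bit :: finite
proof
  have "(UNIV :: bit set) = {0, 1}"
    by (auto intro: bit.exhaust)
  then show "finite (UNIV :: bit set)"
    by (metis finite.emptyI finite.insertI)
qed

section \<open>Spherical codes\<close>

definition spherical_code :: "'a::euclidean_space set \<Rightarrow> bool" where
  "spherical_code C \<longleftrightarrow> finite C \<and> (\<forall>x\<in>C. norm x = 1)"

definition cosine_set :: "'a::euclidean_space set \<Rightarrow> real set" where
  "cosine_set C = {x \<bullet> y | x y. x \<in> C \<and> y \<in> C \<and> x \<noteq> y}"

definition orth_proj :: "'a::euclidean_space set \<Rightarrow> 'a \<Rightarrow> 'a" where
  "orth_proj W x = (THE y. y \<in> W \<and> (\<forall>w\<in>W. orthogonal (x - y) w))"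

definition projected_code :: "'a::euclidean_space set \<Rightarrow> 'a set \<Rightarrow> 'a set" where
  "projected_code W X = (\<lambda>x. orth_proj W x /\<^sub>R norm (orth_proj W x)) ` X"

section \<open>Reed-Muller codes on the four-dimensional binary space\<close>

type_synonym \<Omega> = "bit ^ 4"
type_synonym V = "real ^ \<Omega>"

definition affine_subspaces :: "nat \<Rightarrow> \<Omega> set set" where
  "affine_subspaces r = {(\<lambda>u. a + u) ` U | a U. vec.subspace U \<and> vec.dim U + r = 4}"

text \<open>The binary word of a subset is its characteristic vector, so that addition of words is
  symmetric difference of subsets; it is also the Boolean function with that support.\<close>

definition word :: "\<Omega> set \<Rightarrow> bit ^ \<Omega>" where
  "word A = (\<chi> \<omega>. if \<omega> \<in> A then 1 else 0)"

definition RM :: "nat \<Rightarrow> \<Omega> set set" where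
  "RM r = {A. word A \<in> vec.span (word ` affine_subspaces r)}"

definition polar_form :: "bit ^ \<Omega> \<Rightarrow> \<Omega> \<Rightarrow> \<Omega> \<Rightarrow> \<Omega> \<Rightarrow> bit" where
  "polar_form F x u w = F $ (x + u + w) + F $ (x + u) + F $ (x + w) + F $ x"

text \<open>The rank of the form is that of its Gram matrix in the standard basis. The defect is only
  meaningful for words of \<open>RM 2\<close>, for which the form is alternating (so of even rank) and does
  not depend on the base point, taken to be 0 here.\<close>

definition gram_matrix :: "(\<Omega> \<Rightarrow> \<Omega> \<Rightarrow> bit) \<Rightarrow> bit ^ 4 ^ 4" where
  "gram_matrix B = (\<chi> i j. B (axis i 1) (axis j 1))"

definition defect :: "\<Omega> set \<Rightarrow> nat" where
  "defect A = rank (gram_matrix (polar_form (word A) 0)) div 2"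

section \<open>The groups\<close>

text \<open>All groups act on the right: linear maps are square matrices acting on row vectors by
  \<open>x v* M\<close>, so the product \<open>M ** N\<close> means first \<open>M\<close>, then \<open>N\<close>.\<close>

definition GL :: "('a::field ^ 'n ^ 'n) monoid" where
  "GL = \<lparr>carrier = {M. invertible M}, mult = (**), one = mat 1\<rparr>"

definition eps :: "\<Omega> set \<Rightarrow> real ^ \<Omega> ^ \<Omega>" where
  "eps A = (\<chi> i j. if i = j then (if i \<in> A then - 1 else 1) else 0)"

text \<open>The basis vector indexed by \<open>\<omega>\<close> is sent to the one indexed by \<open>\<omega> v* g\<close>.\<close>

definition perm_matrix :: "bit ^ 4 ^ 4 \<Rightarrow> real ^ \<Omega> ^ \<Omega>" where
  "perm_matrix g = (\<chi> i j. if j = i v* g then 1 else 0)"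

abbreviation \<omega>\<^sub>0 :: \<Omega> where
  "\<omega>\<^sub>0 \<equiv> 0"

definition Q_group :: "\<Omega> \<Rightarrow> \<Omega> set \<Rightarrow> (bit ^ 4 ^ 4) set" where
  "Q_group \<omega>\<^sub>1 B\<^sub>0 = {g \<in> carrier GL. \<omega>\<^sub>1 v* g = \<omega>\<^sub>1 \<and> (\<lambda>b. b v* g) ` B\<^sub>0 = B\<^sub>0}"

definition E_group :: "\<Omega> \<Rightarrow> (real ^ \<Omega> ^ \<Omega>) set" where
  "E_group \<omega>\<^sub>1 = {eps A | A. A \<in> RM 1 \<and> \<omega>\<^sub>0 \<notin> A \<and> \<omega>\<^sub>1 \<notin> A}"

definition J_group :: "\<Omega> \<Rightarrow> (real ^ \<Omega> ^ \<Omega>) set" where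
  "J_group \<omega>\<^sub>1 = {eps A | A. A \<in> RM 2 \<and> \<omega>\<^sub>0 \<notin> A \<and> \<omega>\<^sub>1 \<notin> A}"

definition JQ_group :: "\<Omega> \<Rightarrow> \<Omega> set \<Rightarrow> (real ^ \<Omega> ^ \<Omega>) set" where
  "JQ_group \<omega>\<^sub>1 B\<^sub>0 = {j ** perm_matrix q | j q. j \<in> J_group \<omega>\<^sub>1 \<and> q \<in> Q_group \<omega>\<^sub>1 B\<^sub>0}"

definition \<G> :: "\<Omega> \<Rightarrow> \<Omega> set \<Rightarrow> (real ^ \<Omega> ^ \<Omega>) set set" where
  "\<G> \<omega>\<^sub>1 B\<^sub>0 = {H. subgroup H GL \<and> E_group \<omega>\<^sub>1 \<subseteq> H \<and> H \<subseteq> JQ_group \<omega>\<^sub>1 B\<^sub>0 \<and>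
     (GL\<lparr>carrier := H\<rparr> Mod E_group \<omega>\<^sub>1) \<cong> (GL :: (bit ^ 3 ^ 3) monoid)}"

definition x\<^sub>0 :: V where
  "x\<^sub>0 = (\<Sum>\<omega>\<in>UNIV. axis \<omega> 1)"

definition orbit\<^sub>0 :: "(real ^ \<Omega> ^ \<Omega>) set \<Rightarrow> V set" where
  "orbit\<^sub>0 H = {x\<^sub>0 v* h | h. h \<in> H}"

end

theory Submission
  imports Defs
begin

text \<open>The inner product of two orbit points is the sign sum \<open>16 - 2 |A|\<close> of the word \<open>A\<close> of a
  single element \<open>eps A ** perm_matrix q\<close> of \<open>H\<close>, because \<open>H\<close> consists of orthogonal matrices.
  It is 0 or 16 when \<open>A\<close> is affine, and its square is 16 when \<open>A\<close> is a quadratic word with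
  nondegenerate polar form. If every \<open>A\<close> were affine, the orbit would be orthogonal and have at
  most 16 points, so some \<open>A\<close> has defect 2. Over the coset of \<open>A\<close> modulo the affine words vanishing
  at 0 and \<open>\<omega>\<^sub>1\<close> the sign sums, all equal to 4 or -4, average to 2, because only the positions 0 and
  \<open>\<omega>\<^sub>1\<close> survive the averaging; hence both values occur. All orbit points have entry 1 at
  0 and \<open>\<omega>\<^sub>1\<close>, so deleting \<open>n\<close> of these coordinates turns the inner product \<open>c\<close> into the cosine
  \<open>(c - n) / (16 - n)\<close>.\<close>

text \<open>These rules unfold bit arithmetic to bitwise operations and thereby block the ring laws.\<close>

declare add_bit_eq_xor [simp del] mult_bit_eq_and [simp del]

section \<open>Boolean functions\<close>

lemma bit_add_self [simp]: "b + b = 0" for b :: bit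
  by (cases b) auto

lemma bit_vec_add_self [simp]: "x + x = 0" for x :: "bit ^ 'n"
  by (simp add: vec_eq_iff)

lemma bit_vec_add_left_cancel [simp]: "x + (x + y) = y" for x y :: "bit ^ 'n"
  by (simp flip: add.assoc)

lemma bit_vec_diff [simp]: "x - y = x + y" for x y :: "bit ^ 'n"
  by (simp add: vec_eq_iff)

lemma bit_vec_add_eq_0_iff [simp]: "x + y = 0 \<longleftrightarrow> x = y" for x y :: "bit ^ 'n"
  by (metis bit_vec_diff eq_iff_diff_eq_0)

lemma subspace_bit_iff:
  "vec.subspace S \<longleftrightarrow> 0 \<in> S \<and> (\<forall>x\<in>S. \<forall>y\<in>S. x + y \<in> S)" for S :: "(bit ^ 'n) set"
proof
  assume S: "0 \<in> S \<and> (\<forall>x\<in>S. \<forall>y\<in>S. x + y \<in> S)"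
  have "c *s x \<in> S" if "x \<in> S" for c x
    using that S by (cases c) auto
  with S show "vec.subspace S"
    by (simp add: vec.subspace_def)
qed (auto simp: vec.subspace_def)

lemma word_nth [simp]: "word A $ x = of_bool (x \<in> A)"
  by (simp add: word_def)

lemma word_inject [simp]: "word A = word B \<longleftrightarrow> A = B"
  by (auto simp: vec_eq_iff)

text \<open>Identically vanishing second differences mean degree at most 1, constants included. The
  condition is linear in \<open>F\<close>, so it passes from generators to their span.\<close>

definition is_affine :: "bit ^ \<Omega> \<Rightarrow> bool" where
  "is_affine F \<longleftrightarrow> (\<forall>x u w. polar_form F x u w = 0)"

text \<open>Second differences independent of the base point are the same as vanishing third
  differences, that is, degree at most 2.\<close>

definition is_quadratic :: "bit ^ \<Omega> \<Rightarrow> bool" where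
  "is_quadratic F \<longleftrightarrow> (\<forall>x y u w. polar_form F (x + y) u w = polar_form F x u w)"

lemma polar_form_add: "polar_form (F + G) x u w = polar_form F x u w + polar_form G x u w"
  by (simp add: polar_form_def ac_simps)

lemma polar_form_0: "polar_form 0 x u w = 0"
  by (simp add: polar_form_def)

lemma subspace_is_affine: "vec.subspace {F. is_affine F}"
  by (simp add: subspace_bit_iff is_affine_def polar_form_add polar_form_0)

lemma subspace_is_quadratic: "vec.subspace {F. is_quadratic F}"
  by (simp add: subspace_bit_iff is_quadratic_def polar_form_add polar_form_0)

lemma bit_add_eq_0_iff [simp]: "p + q = 0 \<longleftrightarrow> p = q" for p q :: bit
  by (cases p; cases q) auto

lemma is_affineD:
  assumes "is_affine F"
  shows "F $ (x + u + w) = F $ (x + u) + F $ (x + w) + F $ x"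
proof -
  have "polar_form F x u w = 0"
    using assms by (simp add: is_affine_def)
  then show ?thesis
    by (simp only: polar_form_def add.assoc bit_add_eq_0_iff)
qed

lemma is_affine_add: "is_affine F \<Longrightarrow> F $ 0 = 0 \<Longrightarrow> F $ (u + w) = F $ u + F $ w"
  using is_affineD[of F 0 u w] by simp

text \<open>The bracket is the value at \<open>u\<close> of the linear part of \<open>F\<close>, so
  translation by \<open>u\<close> adds a constant that does not depend on \<open>x\<close>.\<close>

lemma is_affine_translate:
  assumes "is_affine F"
  shows "F $ (x + u) = F $ x + (F $ u + F $ 0)"
  using is_affineD[OF assms, of 0 x u] by (simp add: ac_simps)

text \<open>Up to affine terms the product is l m, with l and m the linear parts of \<open>F\<close>
  and \<open>G\<close>, and its polar form is l(u) m(w) + l(w) m(u). The base point drops out, so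
  such products are quadratic.\<close>

lemma polar_form_mult:
  assumes F: "is_affine F" and G: "is_affine G"
  shows "polar_form (F * G) x u w =
    (F $ u + F $ 0) * (G $ w + G $ 0) + (F $ w + F $ 0) * (G $ u + G $ 0)"
proof -
  \<comment> \<open>\<open>p\<close> and \<open>q\<close> stand for the values of \<open>F\<close>
    and \<open>G\<close> at \<open>x\<close>; translating by \<open>u\<close> adds \<open>s\<close>
    and \<open>s'\<close>, translating by \<open>w\<close> adds \<open>t\<close> and
    \<open>t'\<close>.\<close>
  have bits: "(p + s + t) * (q + s' + t') + (p + s) * (q + s') + (p + t) * (q + t') + p * q =
      s * t' + t * s'" for p q s t s' t' :: bit
    by (cases p; cases q; cases s; cases t; cases s'; cases t'; simp)
  show ?thesis
    unfolding polar_form_def vector_mult_component is_affine_translate[OF F, of _ u]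
      is_affine_translate[OF F, of _ w] is_affine_translate[OF G, of _ u]
      is_affine_translate[OF G, of _ w]
    by (rule bits)
qed

lemma is_quadratic_mult: "is_affine F \<Longrightarrow> is_affine G \<Longrightarrow> is_quadratic (F * G)"
  by (simp add: is_quadratic_def polar_form_mult)

section \<open>Reed-Muller words\<close>

text \<open>A hyperplane over the two-element field has index 2: \<open>U\<close> and
  \<open>x\<close> span everything, so \<open>y\<close> is a member of \<open>U\<close> plus a
  multiple of \<open>x\<close>, and the multiplier is 1 because \<open>y\<close> lies outside
  \<open>U\<close>.\<close>

lemma hyperplane_add_mem:
  fixes U :: "(bit ^ 'n) set"
  assumes U: "vec.subspace U" "vec.dim U + 1 = CARD('n)" and x: "x \<notin> U" and y: "y \<notin> U"
  shows "x + y \<in> U"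
proof -
  have span: "vec.span U = U"
    using U(1) by (simp only: vec.span_eq_iff)
  have "vec.dim (insert x U) = CARD('n)"
    using U x by (simp add: vec.dim_insert span)
  then have "vec.span (insert x U) = UNIV"
    by (metis vec.dim_eq_span[OF subset_UNIV] vec.span_UNIV vec_dim_card order_refl)
  then obtain k where k: "y - k *s x \<in> U"
    using span by (auto simp: vec.span_insert)
  then show ?thesis
    using y by (cases k) (auto simp: add.commute)
qed

lemma coset_mem_iff: "x \<in> (+) a ` U \<longleftrightarrow> x + a \<in> U" for a x :: "bit ^ 'n"
proof
  show "x + a \<in> U" if "x \<in> (+) a ` U"
    using that by (auto simp: ac_simps)
  show "x \<in> (+) a ` U" if "x + a \<in> U"
    using imageI[OF that, of "(+) a"] by (simp add: ac_simps)
qed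

lemma is_affine_word_coset:
  fixes U :: "\<Omega> set"
  assumes U: "vec.subspace U" "vec.dim U = 3"
  shows "is_affine (word ((+) a ` U))"
proof -
  have closed: "x + y \<in> U" if "x \<in> U" "y \<in> U" for x y
    using U(1) that by (simp add: vec.subspace_add)
  have index: "x + y \<in> U" if "x \<notin> U" "y \<notin> U" for x y
    by (rule hyperplane_add_mem) (use U that in simp_all)
  have mixed: "x + y \<notin> U" if "x \<in> U" "y \<notin> U" for x y
    using closed[OF that(1), of "x + y"] that(2) by (metis bit_vec_add_left_cancel)
  \<comment> \<open>Lying outside \<open>U\<close> is a homomorphism to the two-element group, so
    the second difference is a parity count.\<close>
  have mem: "x + y \<in> U \<longleftrightarrow> (x \<in> U \<longleftrightarrow> y \<in> U)" for x y
    using closed[of x y] index[of x y] mixed[of x y] mixed[of y x] add.commute[of x y] by metis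
  have nth: "word ((+) a ` U) $ x = of_bool ((x \<in> U) = (a \<in> U))" for x
    by (simp add: coset_mem_iff mem)
  have "polar_form (word ((+) a ` U)) x u w = 0" for x u w
    unfolding polar_form_def nth mem
    by (cases "x \<in> U"; cases "u \<in> U"; cases "w \<in> U"; cases "a \<in> U"; simp)
  then show ?thesis
    by (simp add: is_affine_def)
qed

text \<open>A coset of a plane is the intersection of cosets of two hyperplanes, so its word is a
  product of two affine words.\<close>

lemma is_quadratic_word_coset:
  fixes U :: "\<Omega> set"
  assumes U: "vec.subspace U" "vec.dim U = 2"
  shows "is_quadratic (word ((+) a ` U))"
proof -
  have span: "vec.span U = U"
    using U(1) by (simp only: vec.span_eq_iff)
  have "U \<noteq> UNIV"
    using U(2) vec_dim_card[where 'a=bit and 'n=4] by auto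
  then obtain x where x: "x \<notin> U"
    by blast
  define U1 where "U1 = vec.span (insert x U)"
  have U1: "vec.subspace U1" "vec.dim U1 = 3" "U \<subseteq> U1"
    using x U(2) by (auto simp: U1_def vec.dim_insert span intro: vec.span_base)
  have "U1 \<noteq> UNIV"
    using U1(2) vec_dim_card[where 'a=bit and 'n=4] by auto
  \<comment> \<open>Choosing \<open>y\<close> outside the first hyperplane makes the two hyperplanes
    meet exactly in \<open>U\<close>.\<close>
  then obtain y where y: "y \<notin> U1"
    by blast
  then have yU: "y \<notin> U"
    using U1(3) by blast
  define U2 where "U2 = vec.span (insert y U)"
  have U2: "vec.subspace U2" "vec.dim U2 = 3" "U \<subseteq> U2"
    using yU U(2) by (auto simp: U2_def vec.dim_insert span intro: vec.span_base)
  have "z \<in> U" if z1: "z \<in> U1" and z2: "z \<in> U2" for z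
  proof -
    obtain k where k: "z - k *s y \<in> U"
      using z2 span by (auto simp: U2_def vec.span_insert)
    have "k \<noteq> 1"
    proof
      assume "k = 1"
      then have "z + y \<in> U1"
        using k U1(3) by auto
      then have "z + (z + y) \<in> U1"
        using z1 U1(1) vec.subspace_add by blast
      then show False
        using y by simp
    qed
    then show ?thesis
      using k by simp
  qed
  then have "word ((+) a ` U) = word ((+) a ` U1) * word ((+) a ` U2)"
    using U1(3) U2(3) by (auto simp: vec_eq_iff coset_mem_iff)
  then show ?thesis
    using is_quadratic_mult is_affine_word_coset U1 U2 by simp
qed

lemma RM_1_is_affine: "A \<in> RM 1 \<Longrightarrow> is_affine (word A)"
proof -
  have "word ` affine_subspaces 1 \<subseteq> {F. is_affine F}"
    by (auto simp: affine_subspaces_def is_affine_word_coset)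
  then show "A \<in> RM 1 \<Longrightarrow> is_affine (word A)"
    using vec.span_minimal[OF _ subspace_is_affine] by (auto simp: RM_def)
qed

lemma RM_2_is_quadratic: "A \<in> RM 2 \<Longrightarrow> is_quadratic (word A)"
proof -
  have "word ` affine_subspaces 2 \<subseteq> {F. is_quadratic F}"
    by (auto simp: affine_subspaces_def is_quadratic_word_coset)
  then show "A \<in> RM 2 \<Longrightarrow> is_quadratic (word A)"
    using vec.span_minimal[OF _ subspace_is_quadratic] by (auto simp: RM_def)
qed

text \<open>The line through 0 and \<open>\<omega>\<^sub>1\<close> has no third point, so
  \<open>\<omega>\<close> and \<open>\<omega>\<^sub>1\<close> are independent. Dropping
  \<open>\<omega>\<close> from a basis containing both leaves a hyperplane through 0 and
  \<open>\<omega>\<^sub>1\<close> that misses \<open>\<omega>\<close>; the set sought is its other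
  coset.\<close>

lemma RM_1_separates:
  assumes "\<omega>\<^sub>1 \<noteq> 0" "\<omega> \<noteq> 0" "\<omega> \<noteq> \<omega>\<^sub>1"
  obtains A where "A \<in> RM 1" "0 \<notin> A" "\<omega>\<^sub>1 \<notin> A" "\<omega> \<in> A"
proof -
  have "\<omega> \<notin> vec.span {\<omega>\<^sub>1}"
  proof
    assume "\<omega> \<in> vec.span {\<omega>\<^sub>1}"
    then obtain k where "\<omega> = k *s \<omega>\<^sub>1"
      by (auto simp: vec.span_insert)
    then show False
      using assms by (cases k) auto
  qed
  then have indep: "vec.independent {\<omega>, \<omega>\<^sub>1}"
    using assms by (simp add: vec.independent_insert)
  define B where "B = vec.extend_basis {\<omega>, \<omega>\<^sub>1}"
  have B: "{\<omega>, \<omega>\<^sub>1} \<subseteq> B" "vec.independent B" "vec.span B = UNIV"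
    unfolding B_def by (rule vec.extend_basis_superset[OF indep]
        vec.independent_extend_basis[OF indep] vec.span_extend_basis[OF indep])+
  have card_B: "card B = 4"
    using vec.indep_card_eq_dim_span[OF B(2)] by (simp only: B(3) vec_dim_card) simp
  define U where "U = vec.span (B - {\<omega>})"
  have indep': "vec.independent (B - {\<omega>})"
    using B(2) vec.independent_mono by blast
  have U: "vec.subspace U" "vec.dim U = 3" "\<omega>\<^sub>1 \<in> U" "\<omega> \<notin> U"
    using B(1,2) card_B assms(3) vec.dim_span_eq_card_independent[OF indep']
    by (auto simp: U_def vec.dependent_def intro!: vec.span_base)
  have RM: "(+) \<omega> ` U \<in> RM 1"
    using U(1,2) by (auto simp: RM_def affine_subspaces_def intro!: vec.span_base)
  have "\<omega>\<^sub>1 \<notin> (+) \<omega> ` U"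
  proof
    assume "\<omega>\<^sub>1 \<in> (+) \<omega> ` U"
    then have "\<omega>\<^sub>1 + (\<omega>\<^sub>1 + \<omega>) \<in> U"
      using U(1,3) vec.subspace_add unfolding coset_mem_iff by blast
    then show False
      using U(4) by simp
  qed
  moreover have "0 \<notin> (+) \<omega> ` U" "\<omega> \<in> (+) \<omega> ` U"
    unfolding coset_mem_iff using U(4) vec.subspace_0[OF U(1)] by simp_all
  ultimately show ?thesis
    using RM that by blast
qed

section \<open>Sign sums\<close>

text \<open>The nontrivial additive character of the two-element field: it turns sums of words into
  products of signs.\<close>

definition bit_sign :: "bit \<Rightarrow> real" where
  "bit_sign b = (if b = 0 then 1 else - 1)"

definition sign_sum :: "bit ^ \<Omega> \<Rightarrow> real" where
  "sign_sum F = (\<Sum>x\<in>UNIV. bit_sign (F $ x))"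

lemma card_bit [simp]: "CARD(bit) = 2"
proof -
  have "(UNIV :: bit set) = {0, 1}"
    by (auto intro: bit.exhaust)
  then show ?thesis
    unfolding card_2_iff using zero_neq_one by blast
qed

lemma bit_sign_simps [simp]: "bit_sign 0 = 1" "bit_sign 1 = - 1"
  by (simp_all add: bit_sign_def)

lemma bit_sign_add: "bit_sign (b + c) = bit_sign b * bit_sign c"
  by (cases b; cases c) simp_all

lemma bit_sign_mult_self [simp]: "bit_sign b * bit_sign b = 1"
  by (cases b) simp_all

lemma sum_translate: "(\<Sum>x\<in>UNIV. f (x + a)) = (\<Sum>x\<in>UNIV. f x)" for a :: \<Omega> and f :: "\<Omega> \<Rightarrow> real"
  by (rule sum.reindex_bij_witness[of _ "\<lambda>x. x + a" "\<lambda>x. x + a"]) (simp_all add: add.assoc)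

text \<open>Translation by \<open>a\<close> permutes the points and flips every sign, so the sum
  equals its own negative.\<close>

lemma sum_sign_eq_0:
  fixes f :: "\<Omega> \<Rightarrow> bit"
  assumes "\<And>x. f (x + a) = f x + 1"
  shows "(\<Sum>x\<in>UNIV. bit_sign (f x)) = 0"
proof -
  have "(\<Sum>x\<in>UNIV. bit_sign (f x)) = (\<Sum>x\<in>UNIV. bit_sign (f (x + a)))"
    using sum_translate[of "\<lambda>x. bit_sign (f x)" a] by (rule sym)
  also have "\<dots> = - (\<Sum>x\<in>UNIV. bit_sign (f x))"
    by (simp add: assms bit_sign_add sum_negf)
  finally show ?thesis
    by simp
qed

text \<open>With value 0 at 0 the function is linear, so translating by a point of value 1 flips all
  signs. The normalization excludes the constant 1, whose sign sum is -16.\<close>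

lemma sign_sum_affine:
  assumes F: "is_affine F" "F $ 0 = 0"
  shows "F \<noteq> 0 \<Longrightarrow> sign_sum F = 0" "sign_sum 0 = 16"
proof -
  show "sign_sum F = 0" if nz: "F \<noteq> 0"
  proof -
    obtain a where "F $ a = 1"
      using nz by (auto simp: vec_eq_iff)
    then show ?thesis
      unfolding sign_sum_def by (intro sum_sign_eq_0[of _ a]) (simp add: is_affine_add[OF F])
  qed
  show "sign_sum 0 = 16"
    by (simp add: sign_sum_def)
qed

text \<open>Squaring gives one sign sum for each first difference F(x) + F(x + u). For nonzero
  \<open>u\<close> that difference is a nonconstant affine function of \<open>x\<close>, so only
  \<open>u = 0\<close> contributes.\<close>

lemma sign_sum_quadratic:
  assumes F: "is_quadratic F" and nondeg: "\<And>u. \<forall>w. polar_form F 0 u w = 0 \<Longrightarrow> u = 0"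
  shows "(sign_sum F)\<^sup>2 = 16"
proof -
  have translate: "F $ (x + w) + F $ (x + w + u) = F $ x + F $ (x + u) + polar_form F 0 u w" for x u w
  proof -
    have "polar_form F 0 u w = polar_form F (0 + x) u w"
      using F by (simp only: is_quadratic_def)
    also have "\<dots> = F $ (x + w + u) + F $ (x + u) + F $ (x + w) + F $ x"
      by (simp add: polar_form_def ac_simps)
    finally show ?thesis
      by (cases "F $ (x + w + u)"; cases "F $ (x + u)"; cases "F $ (x + w)"; cases "F $ x"; simp)
  qed
  have "(sign_sum F)\<^sup>2 = (\<Sum>x\<in>UNIV. \<Sum>u\<in>UNIV. bit_sign (F $ x) * bit_sign (F $ u))"
    by (simp add: sign_sum_def power2_eq_square sum_product)
  also have "\<dots> = (\<Sum>x\<in>UNIV. \<Sum>u\<in>UNIV. bit_sign (F $ x) * bit_sign (F $ (u + x)))"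
    by (intro sum.cong refl sum_translate[symmetric])
  also have "\<dots> = (\<Sum>x\<in>UNIV. \<Sum>u\<in>UNIV. bit_sign (F $ x + F $ (x + u)))"
    by (simp add: bit_sign_add add.commute)
  also have "\<dots> = (\<Sum>u\<in>UNIV. \<Sum>x\<in>UNIV. bit_sign (F $ x + F $ (x + u)))"
    by (rule sum.swap)
  also have "\<dots> = (\<Sum>u\<in>(UNIV :: \<Omega> set). if u = 0 then 16 else 0)"
  proof (rule sum.cong[OF refl])
    fix u :: \<Omega>
    show "(\<Sum>x\<in>UNIV. bit_sign (F $ x + F $ (x + u))) = (if u = 0 then 16 else 0)"
    proof (cases "u = 0")
      case False
      \<comment> \<open>Translating \<open>x\<close> by this \<open>w\<close> adds 1 to the first
        difference in direction \<open>u\<close>.\<close>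
      then obtain w where "polar_form F 0 u w = 1"
        using nondeg by (meson bit_not_zero_iff)
      then show ?thesis
        using False by (simp add: sum_sign_eq_0[of _ w] translate)
    qed simp
  qed
  finally show ?thesis
    by simp
qed

lemma defect_2_nondegenerate:
  assumes F: "is_quadratic (word A)" and "defect A = 2" and u: "\<forall>w. polar_form (word A) 0 u w = 0"
  shows "u = 0"
proof -
  define G where "G = gram_matrix (polar_form (word A) 0)"
  have symmetric: "polar_form (word A) 0 u w = polar_form (word A) 0 w u" for u w
    by (simp add: polar_form_def ac_simps)
  have "polar_form (word A) 0 (u + v) w = polar_form (word A) 0 u w + polar_form (word A) 0 v w" (is "?p = ?q + ?r") for u v w
  proof -
    \<comment> \<open>Additivity comes from moving the base point to \<open>v\<close>: the terms at
      \<open>w\<close> and 0 cancel in the sum of the two forms based at 0.\<close>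
    have "polar_form (word A) 0 u w = polar_form (word A) (0 + v) u w"
      using F by (simp only: is_quadratic_def)
    also have "\<dots> = polar_form (word A) 0 (u + v) w + polar_form (word A) 0 v w"
      by (simp add: polar_form_def ac_simps)
    finally show ?thesis
      by (cases ?p; cases ?q; cases ?r; simp)
  qed
  then have additive: "Modules.additive (\<lambda>u. polar_form (word A) 0 u w)" for w
    by unfold_locales
  have scale: "polar_form (word A) 0 (c *s v) w = c * polar_form (word A) 0 v w" for c v w
    using Modules.additive.zero[OF additive[of w]] by (cases c) simp_all
  have "(G *v u) $ i = 0" for i
  proof -
    have "(G *v u) $ i = (\<Sum>j\<in>UNIV. polar_form (word A) 0 (u $ j *s axis j 1) (axis i 1))"
      by (simp add: matrix_vector_mult_def G_def gram_matrix_def scale mult.commute)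
        (intro sum.cong refl arg_cong2[where f = "(*)"] symmetric)
    also have "\<dots> = polar_form (word A) 0 (\<Sum>j\<in>UNIV. u $ j *s axis j 1) (axis i 1)"
      by (rule Modules.additive.sum[OF additive, symmetric])
    also have "\<dots> = 0"
      by (simp only: basis_expansion u)
    finally show ?thesis .
  qed
  then have "G *v u = 0"
    by (simp add: vec_eq_iff)
  moreover have "vec.span (rows G) = UNIV"
  proof -
    \<comment> \<open>The division leaves rank 4 or 5, and there are only four columns; so the Gram
      matrix is invertible, while it annihilates \<open>u\<close>.\<close>
    have "vec.dim (rows G) div 2 = 2"
      using assms(2) by (simp add: defect_def G_def row_rank_def_gen)
    moreover have "vec.dim (rows G) \<le> CARD(4)"
      by (rule dim_subset_UNIV_cart_gen)
    ultimately have "vec.dim (rows G) = vec.dim (UNIV :: \<Omega> set)"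
      unfolding vec_dim_card by simp
    then show ?thesis
      using vec.dim_eq_span[OF subset_UNIV, of "rows G"] by simp
  qed
  ultimately show ?thesis
    using matrix_left_invertible_span_rows_gen[of G] matrix_left_invertible_ker[of G] by blast
qed

lemma sign_sum_RM_1: "A \<in> RM 1 \<Longrightarrow> 0 \<notin> A \<Longrightarrow> sign_sum (word A) \<in> {0, 16}"
  using sign_sum_affine[OF RM_1_is_affine] by (cases "word A = 0") auto

lemma sign_sum_defect_2: "A \<in> RM 2 \<Longrightarrow> defect A = 2 \<Longrightarrow> sign_sum (word A) \<in> {4, - 4}"
proof -
  assume A: "A \<in> RM 2" "defect A = 2"
  have "(sign_sum (word A))\<^sup>2 = 4\<^sup>2"
    using sign_sum_quadratic[OF RM_2_is_quadratic[OF A(1)]]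
      defect_2_nondegenerate[OF RM_2_is_quadratic[OF A(1)] A(2)] by simp
  then show ?thesis
    unfolding power2_eq_iff by simp
qed

text \<open>Dual to \<open>sum_sign_eq_0\<close>: the point is fixed and the word varies. Adding
  \<open>G\<close> permutes \<open>W\<close> and flips the sign at \<open>x\<close>.\<close>

lemma sum_sign_words:
  fixes W :: "(bit ^ 'n) set"
  assumes W: "\<And>F G. F \<in> W \<Longrightarrow> G \<in> W \<Longrightarrow> F + G \<in> W" and G: "G \<in> W" "G $ x = 1"
  shows "(\<Sum>F\<in>W. bit_sign (F $ x)) = 0"
proof -
  have "(\<Sum>F\<in>W. bit_sign (F $ x)) = (\<Sum>F\<in>W. bit_sign ((F + G) $ x))"
    by (rule sum.reindex_bij_witness[of _ "\<lambda>F. F + G" "\<lambda>F. F + G"])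
      (auto simp: W G(1) add.assoc)
  also have "\<dots> = - (\<Sum>F\<in>W. bit_sign (F $ x))"
    by (simp add: bit_sign_add G(2) sum_negf)
  finally show ?thesis
    by simp
qed

section \<open>Projections\<close>

text \<open>The projection sets the coordinates in \<open>S\<close> to 0. As all points of
  \<open>X\<close> have entry 1 there, each inner product drops by \<open>card S\<close>, and so
  does the common squared norm \<open>N\<close>.\<close>

lemma coordinate_code:
  fixes X :: "(real ^ 'n) set" and S :: "'n set" and N :: real
  defines "W \<equiv> {x. \<forall>i\<in>S. x $ i = 0}"
  assumes X: "finite X" "\<And>x i. x \<in> X \<Longrightarrow> i \<in> S \<Longrightarrow> x $ i = 1" "\<And>x. x \<in> X \<Longrightarrow> x \<bullet> x = N"
    and N: "N > card S"
  shows "dim W = CARD('n) - card S"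
    and "projected_code W X \<subseteq> W"
    and "spherical_code (projected_code W X)"
    and "cosine_set (projected_code W X) =
      (\<lambda>c::real. (c - card S) / (N - card S)) ` {x \<bullet> y | x y. x \<in> X \<and> y \<in> X \<and> x \<noteq> y}"
proof -
  have "W = {x. \<forall>i. i \<notin> - S \<longrightarrow> x $ i = 0}"
    by (auto simp: W_def)
  then show "dim W = CARD('n) - card S"
    using dim_substandard_cart[where 'a=real, of "- S"] by (simp add: dim_vec_eq Compl_eq_Diff_UNIV card_Diff_subset)
  define p :: "real ^ 'n \<Rightarrow> real ^ 'n" where "p x = (\<chi> i. if i \<in> S then 0 else x $ i)" for x
  have orth: "orthogonal (x - p x) w" if "w \<in> W" for x w
    unfolding orthogonal_def inner_vec_def
    by (rule sum.neutral) (use that in \<open>auto simp: p_def W_def\<close>)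
  have proj: "orth_proj W x = p x" for x
    unfolding orth_proj_def
  proof (rule the_equality)
    show "p x \<in> W \<and> (\<forall>w\<in>W. orthogonal (x - p x) w)"
      using orth by (auto simp: p_def W_def)
    fix y
    assume y: "y \<in> W \<and> (\<forall>w\<in>W. orthogonal (x - y) w)"
    then have "y - p x \<in> W"
      by (auto simp: p_def W_def)
    \<comment> \<open>The difference of the two residuals is \<open>y - p x\<close>, which is
      therefore orthogonal to itself.\<close>
    then have "orthogonal (x - y) (y - p x)" "orthogonal (x - p x) (y - p x)"
      using y orth by auto
    then have "(y - p x) \<bullet> (y - p x) = 0"
      by (simp add: orthogonal_def inner_diff_left)
    then show "y = p x"
      by simp
  qed
  have inner_p: "p x \<bullet> p y = x \<bullet> y - card S" if "x \<in> X" "y \<in> X" for x y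
  proof -
    have "p x \<bullet> p y = (\<Sum>i\<in>UNIV. x $ i * y $ i - (if i \<in> S then 1 else 0))"
      unfolding inner_vec_def by (rule sum.cong) (use that X(2) in \<open>auto simp: p_def\<close>)
    also have "\<dots> = x \<bullet> y - card S"
      by (simp add: inner_vec_def sum_subtractf sum.If_cases)
    finally show ?thesis .
  qed
  define r where "r = sqrt (N - card S)"
  have r: "r > 0" "r * r = N - card S"
    using N by (simp_all add: r_def)
  have norm_p: "norm (p x) = r" if "x \<in> X" for x
    using inner_p[OF that that] X(3)[OF that] by (simp add: norm_eq_sqrt_inner r_def)
  define q where "q x = p x /\<^sub>R r" for x
  have code: "projected_code W X = q ` X"
    unfolding projected_code_def proj q_def using norm_p by (intro image_cong) auto
  have norm_q: "norm (q x) = 1" if "x \<in> X" for x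
    using norm_p[OF that] r(1) by (simp add: q_def)
  have inner_q: "q x \<bullet> q y = (x \<bullet> y - card S) / (N - card S)" if "x \<in> X" "y \<in> X" for x y
    by (simp add: q_def inner_p[OF that] r(2)[symmetric] divide_inverse)
  \<comment> \<open>Distinct points must stay distinct, since the cosine set ranges over distinct
    images; they already agree on \<open>S\<close>.\<close>
  have inj: "x = y" if "x \<in> X" "y \<in> X" "q x = q y" for x y
  proof -
    have "p x = p y"
      using that(3) r(1) by (simp add: q_def)
    then have "x $ i = y $ i" for i
      using X(2) that(1,2) by (cases "i \<in> S") (auto simp: p_def vec_eq_iff split: if_splits)
    then show ?thesis
      by (simp add: vec_eq_iff)
  qed
  show "projected_code W X \<subseteq> W"
    unfolding code by (auto simp: q_def p_def W_def)
  show "spherical_code (projected_code W X)"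
    using X(1) norm_q by (simp add: code spherical_code_def)
  show "cosine_set (projected_code W X) =
      (\<lambda>c::real. (c - card S) / (N - card S)) ` {x \<bullet> y | x y. x \<in> X \<and> y \<in> X \<and> x \<noteq> y}"
    (is "?L = ?R")
  proof
    show "?L \<subseteq> ?R"
    proof
      fix c
      assume "c \<in> ?L"
      then obtain x y where xy: "x \<in> X" "y \<in> X" "q x \<noteq> q y" "c = q x \<bullet> q y"
        unfolding cosine_set_def code by blast
      then have "x \<noteq> y"
        by blast
      then show "c \<in> ?R"
        unfolding xy(4) inner_q[OF xy(1,2)] using xy(1,2) by blast
    qed
    show "?R \<subseteq> ?L"
    proof
      fix c
      assume "c \<in> ?R"
      then obtain x y where xy: "x \<in> X" "y \<in> X" "x \<noteq> y" "c = (x \<bullet> y - card S) / (N - card S)"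
        by blast
      then have "q x \<noteq> q y"
        using inj by blast
      then show "c \<in> ?L"
        unfolding xy(4) inner_q[OF xy(1,2), symmetric] cosine_set_def code using xy(1,2) by blast
    qed
  qed
qed

section \<open>Signed permutation matrices\<close>

lemma bit_sign_of_bool: "bit_sign (of_bool b) = (if b then - 1 else 1)"
  by simp

lemma eps_mult_nth: "(eps A ** M) $ i $ j = bit_sign (word A $ i) * M $ i $ j"
proof -
  have "(eps A ** M) $ i $ j = (\<Sum>k\<in>UNIV. if i = k then bit_sign (word A $ i) * M $ i $ j else 0)"
    unfolding matrix_matrix_mult_def vec_lambda_beta
    by (rule sum.cong) (simp_all add: eps_def bit_sign_of_bool)
  then show ?thesis
    by simp
qed

lemma eps_perm_nth:
  "(eps A ** perm_matrix q) $ i $ j = (if j = i v* q then bit_sign (word A $ i) else 0)"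
  unfolding eps_mult_nth by (simp add: perm_matrix_def)

lemma eps_mult_eps: "word C = word A + word B \<Longrightarrow> eps A ** (eps B ** M) = eps C ** M"
  by (simp add: vec_eq_iff eps_mult_nth bit_sign_add del: word_nth)

text \<open>In row \<open>i\<close> the entry in column \<open>i v* q\<close> is a sign, hence
  nonzero on both sides. So what is known of one decomposition of an element of \<open>H\<close>
  holds for the set in any other.\<close>

lemma eps_perm_inject: "eps A ** perm_matrix q = eps B ** perm_matrix r \<Longrightarrow> A = B"
proof -
  assume eq: "eps A ** perm_matrix q = eps B ** perm_matrix r"
  have "word A $ i = word B $ i" for i
  proof -
    have "bit_sign (word A $ i) = (if i v* q = i v* r then bit_sign (word B $ i) else 0)"
      using arg_cong[OF eq, of "\<lambda>M. M $ i $ (i v* q)"] by (simp only: eps_perm_nth) simp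
    then show ?thesis
      by (simp add: bit_sign_of_bool split: if_splits)
  qed
  then show "A = B"
    by (simp add: vec_eq_iff flip: word_inject)
qed

lemma Q_group_inject:
  assumes "q \<in> Q_group \<omega>\<^sub>1 B\<^sub>0"
  shows "i v* q = j v* q \<longleftrightarrow> i = j"
proof -
  obtain q' where q': "q ** q' = mat 1"
    using assms by (auto simp: Q_group_def GL_def invertible_def)
  have "i = (i v* q) v* q'" for i
    by (simp add: vector_matrix_mul_assoc q')
  then show ?thesis
    by metis
qed

lemma orthogonal_eps_perm:
  assumes "q \<in> Q_group \<omega>\<^sub>1 B\<^sub>0"
  shows "orthogonal_matrix (eps A ** perm_matrix q)"
proof -
  let ?M = "eps A ** perm_matrix q"
  have "(?M ** transpose ?M) $ i $ j = mat 1 $ i $ j" for i j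
  proof -
    have "(?M ** transpose ?M) $ i $ j = (\<Sum>k\<in>UNIV. if k = i v* q then
        (if i v* q = j v* q then bit_sign (word A $ i) * bit_sign (word A $ j) else 0) else 0)"
      unfolding matrix_matrix_mult_def[of ?M] transpose_def vec_lambda_beta eps_perm_nth
      by (rule sum.cong) auto
    also have "\<dots> = mat 1 $ i $ j"
      by (simp add: Q_group_inject[OF assms] mat_def del: word_nth)
    finally show ?thesis .
  qed
  then have "?M ** transpose ?M = mat 1"
    by (simp add: vec_eq_iff)
  then show ?thesis
    by (simp add: orthogonal_matrix matrix_left_right_inverse)
qed

lemma x\<^sub>0_nth [simp]: "x\<^sub>0 $ i = 1"
  by (simp add: x\<^sub>0_def axis_def)

lemma x\<^sub>0_eps_perm_nth: "(x\<^sub>0 v* (eps A ** perm_matrix q)) $ j =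
    (\<Sum>i\<in>UNIV. if j = i v* q then bit_sign (word A $ i) else 0)"
  by (simp only: vector_matrix_mult_def vec_lambda_beta x\<^sub>0_nth eps_perm_nth mult_1)

lemma x\<^sub>0_eps_perm_nth_image:
  assumes "q \<in> Q_group \<omega>\<^sub>1 B\<^sub>0"
  shows "(x\<^sub>0 v* (eps A ** perm_matrix q)) $ (j v* q) = bit_sign (word A $ j)"
  unfolding x\<^sub>0_eps_perm_nth Q_group_inject[OF assms] by simp

text \<open>Pairing with the all-one vector adds up all matrix entries; row \<open>i\<close>
  contributes just its sign, wherever \<open>q\<close> puts it.\<close>

lemma inner_x\<^sub>0_eps_perm: "x\<^sub>0 \<bullet> (x\<^sub>0 v* (eps A ** perm_matrix q)) = sign_sum (word A)"
proof -
  have "x\<^sub>0 \<bullet> (x\<^sub>0 v* (eps A ** perm_matrix q)) =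
      (\<Sum>j\<in>UNIV. \<Sum>i\<in>UNIV. if j = i v* q then bit_sign (word A $ i) else 0)"
    by (simp only: inner_vec_def x\<^sub>0_nth x\<^sub>0_eps_perm_nth inner_real_def mult_1)
  also have "\<dots> = (\<Sum>i\<in>UNIV. \<Sum>j\<in>UNIV. if j = i v* q then bit_sign (word A $ i) else 0)"
    by (rule sum.swap)
  also have "\<dots> = sign_sum (word A)"
    by (simp add: sign_sum_def)
  finally show ?thesis .
qed

text \<open>For orthogonal \<open>M\<close> the transpose is the inverse, so a pair of orbit points
  reduces to \<open>x\<^sub>0\<close> and its image under one group element.\<close>

lemma inner_mult_orthogonal_matrix: "(x v* M) \<bullet> (y v* N) = x \<bullet> (y v* (N ** transpose M))"
  for M N :: "real ^ 'n ^ 'n"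
  by (simp add: dot_lmul_matrix flip: vector_transpose_matrix vector_matrix_mul_assoc)

lemma inv_GL_orthogonal:
  fixes h :: "real ^ 'n ^ 'n"
  assumes "orthogonal_matrix h"
  shows "inv\<^bsub>GL\<^esub> h = transpose h"
  unfolding m_inv_def
proof (rule the_equality)
  have t: "transpose h ** h = mat 1" "h ** transpose h = mat 1"
    using assms by (auto simp: orthogonal_matrix_def)
  then show "transpose h \<in> carrier GL \<and> h \<otimes>\<^bsub>GL\<^esub> transpose h = \<one>\<^bsub>GL\<^esub> \<and> transpose h \<otimes>\<^bsub>GL\<^esub> h = \<one>\<^bsub>GL\<^esub>"
    by (auto simp: GL_def invertible_def)
  fix g
  assume "g \<in> carrier GL \<and> h \<otimes>\<^bsub>GL\<^esub> g = \<one>\<^bsub>GL\<^esub> \<and> g \<otimes>\<^bsub>GL\<^esub> h = \<one>\<^bsub>GL\<^esub>"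
  then have gh: "g ** h = mat 1"
    by (simp add: GL_def)
  have "g = (g ** h) ** transpose h"
    by (simp add: t(2) flip: matrix_mul_assoc)
  then show "g = transpose h"
    by (simp add: gh)
qed

lemma orthogonal_comp_axes:
  fixes S :: "'n::finite set"
  shows "(span ((\<lambda>i. axis i 1) ` S))\<^sup>\<bottom> = {x :: real ^ 'n. \<forall>i\<in>S. x $ i = 0}"
proof
  show "(span ((\<lambda>i. axis i 1) ` S))\<^sup>\<bottom> \<subseteq> {x :: real ^ 'n. \<forall>i\<in>S. x $ i = 0}"
  proof clarify
    fix x :: "real ^ 'n" and i
    assume x: "x \<in> (span ((\<lambda>i. axis i 1) ` S))\<^sup>\<bottom>" and "i \<in> S"
    then have "axis i 1 \<in> span ((\<lambda>i. axis i (1::real)) ` S)"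
      by (intro span_base) simp
    then have "orthogonal (axis i 1) x"
      using x by (simp add: orthogonal_comp_def)
    then show "x $ i = 0"
      by (simp add: orthogonal_def inner_axis')
  qed
  show "{x :: real ^ 'n. \<forall>i\<in>S. x $ i = 0} \<subseteq> (span ((\<lambda>i. axis i 1) ` S))\<^sup>\<bottom>"
  proof (clarsimp simp: orthogonal_comp_def)
    fix x y :: "real ^ 'n"
    assume x: "\<forall>i\<in>S. x $ i = 0" and y: "y \<in> span ((\<lambda>i. axis i 1) ` S)"
    have "orthogonal x y"
      by (rule orthogonal_to_span[OF y]) (use x in \<open>auto simp: orthogonal_def inner_axis\<close>)
    then show "orthogonal y x"
      by (rule orthogonal_commute[THEN iffD1])
  qed
qed

section \<open>The orbit\<close>

text \<open>The first three conclusions are what \<open>coordinate_code\<close> asks for, with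
  \<open>N = 16\<close>; the last one determines all three cosine sets.\<close>

lemma inner_products_orbit:
  assumes "\<omega>\<^sub>1 \<noteq> 0" and "H \<in> \<G> \<omega>\<^sub>1 B\<^sub>0"
    and defect: "\<forall>A\<in>RM 2. \<forall>q\<in>Q_group \<omega>\<^sub>1 B\<^sub>0. eps A ** perm_matrix q \<in> H \<longrightarrow>
           A \<in> RM 1 \<or> defect A = 2"
    and card: "card (orbit\<^sub>0 H) = 64"
  shows "finite (orbit\<^sub>0 H)"
    and "\<And>y. y \<in> orbit\<^sub>0 H \<Longrightarrow> y $ 0 = 1 \<and> y $ \<omega>\<^sub>1 = 1"
    and "\<And>y. y \<in> orbit\<^sub>0 H \<Longrightarrow> y \<bullet> y = 16"
    and "{y \<bullet> z | y z. y \<in> orbit\<^sub>0 H \<and> z \<in> orbit\<^sub>0 H \<and> y \<noteq> z} = {0, 4, - 4}"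
proof -
  show "finite (orbit\<^sub>0 H)"
    using card by (intro card_ge_0_finite) simp
  have H: "subgroup H GL" "E_group \<omega>\<^sub>1 \<subseteq> H" "H \<subseteq> JQ_group \<omega>\<^sub>1 B\<^sub>0"
    using assms(2) by (auto simp: \<G>_def)
  have decomp: "\<exists>A q. h = eps A ** perm_matrix q \<and> A \<in> RM 2 \<and> 0 \<notin> A \<and> \<omega>\<^sub>1 \<notin> A \<and> q \<in> Q_group \<omega>\<^sub>1 B\<^sub>0"
    if "h \<in> H" for h
    using subsetD[OF H(3) that] unfolding JQ_group_def J_group_def by blast
  have RM_2: "A \<in> RM 2 \<and> 0 \<notin> A \<and> \<omega>\<^sub>1 \<notin> A" if "eps A ** perm_matrix q \<in> H" for A q
    using decomp[OF that] by (metis eps_perm_inject)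
  have orth: "orthogonal_matrix h" if "h \<in> H" for h
    using decomp[OF that] orthogonal_eps_perm by blast
  have transpose_mem: "transpose h \<in> H" if "h \<in> H" for h
    using subgroup.m_inv_closed[OF H(1) that] by (simp add: inv_GL_orthogonal orth[OF that])
  have mult_mem: "g ** h \<in> H" if "g \<in> H" "h \<in> H" for g h
    using subgroup.m_closed[OF H(1) that] by (simp add: GL_def)
  have one_mem: "mat 1 \<in> H"
    using subgroup.one_closed[OF H(1)] by (simp add: GL_def)
  have orbit_inner: "\<exists>h\<in>H. y \<bullet> z = x\<^sub>0 \<bullet> (x\<^sub>0 v* h)" if yz: "y \<in> orbit\<^sub>0 H" "z \<in> orbit\<^sub>0 H" for y z
  proof -
    obtain g h where gh: "g \<in> H" "h \<in> H" "y = x\<^sub>0 v* g" "z = x\<^sub>0 v* h"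
      using yz by (auto simp: orbit\<^sub>0_def)
    then have "h ** transpose g \<in> H"
      using mult_mem transpose_mem by blast
    then show ?thesis
      unfolding gh(3,4) inner_mult_orthogonal_matrix by blast
  qed
  show coords: "y $ 0 = 1 \<and> y $ \<omega>\<^sub>1 = 1" if y: "y \<in> orbit\<^sub>0 H" for y
  proof -
    obtain h where h: "h \<in> H" "y = x\<^sub>0 v* h"
      using y by (auto simp: orbit\<^sub>0_def)
    obtain A q where Aq: "h = eps A ** perm_matrix q" "0 \<notin> A" "\<omega>\<^sub>1 \<notin> A" "q \<in> Q_group \<omega>\<^sub>1 B\<^sub>0"
      using decomp[OF h(1)] by blast
    have "\<omega>\<^sub>1 v* q = \<omega>\<^sub>1"
      using Aq(4) by (simp add: Q_group_def)
    then show ?thesis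
      using x\<^sub>0_eps_perm_nth_image[OF Aq(4), of A 0] x\<^sub>0_eps_perm_nth_image[OF Aq(4), of A \<omega>\<^sub>1] Aq(2,3)
      by (simp add: h(2) Aq(1))
  qed
  show norm: "y \<bullet> y = 16" if y: "y \<in> orbit\<^sub>0 H" for y
  proof -
    obtain h where h: "h \<in> H" "y = x\<^sub>0 v* h"
      using y by (auto simp: orbit\<^sub>0_def)
    have "h ** transpose h = mat 1"
      using orth[OF h(1)] by (simp add: orthogonal_matrix_def)
    then show ?thesis
      by (simp add: h(2) inner_mult_orthogonal_matrix) (simp add: inner_vec_def)
  qed
  let ?D = "{y \<bullet> z | y z. y \<in> orbit\<^sub>0 H \<and> z \<in> orbit\<^sub>0 H \<and> y \<noteq> z}"
  have not_16: "y \<bullet> z \<noteq> 16" if "y \<in> orbit\<^sub>0 H" "z \<in> orbit\<^sub>0 H" "y \<noteq> z" for y z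
  proof
    assume "y \<bullet> z = 16"
    then have "(y - z) \<bullet> (y - z) = 0"
      using norm[OF that(1)] norm[OF that(2)] by (simp add: inner_diff inner_commute)
    then show False
      using that(3) by simp
  qed
  have witness: "c \<in> ?D" if "h \<in> H" "x\<^sub>0 \<bullet> (x\<^sub>0 v* h) = c" "c \<noteq> 16" for h c
  proof -
    have "x\<^sub>0 \<in> orbit\<^sub>0 H" "x\<^sub>0 v* h \<in> orbit\<^sub>0 H"
      using one_mem that(1) unfolding orbit\<^sub>0_def by (force intro: vector_matrix_mul_rid[symmetric])+
    moreover have "x\<^sub>0 \<noteq> x\<^sub>0 v* h"
      \<comment> \<open>Equal points would have inner product 16, which \<open>c\<close> is
        not.\<close>
      using that norm[OF \<open>x\<^sub>0 \<in> orbit\<^sub>0 H\<close>] by auto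
    ultimately show ?thesis
      using that(2) by blast
  qed
  have value_RM_1: "x\<^sub>0 \<bullet> (x\<^sub>0 v* h) \<in> {0, 16}"
    if "h = eps A ** perm_matrix q" "A \<in> RM 1" "0 \<notin> A" for h A q
    using sign_sum_RM_1[OF that(2,3)] by (simp add: that(1) inner_x\<^sub>0_eps_perm)
  have value_defect_2: "x\<^sub>0 \<bullet> (x\<^sub>0 v* h) \<in> {4, - 4}"
    if "h = eps A ** perm_matrix q" "A \<in> RM 2" "defect A = 2" for h A q
    using sign_sum_defect_2[OF that(2,3)] by (simp add: that(1) inner_x\<^sub>0_eps_perm)
  have "?D \<subseteq> {0, 4, - 4}"
  proof
    fix c
    assume "c \<in> ?D"
    then obtain y z where yz: "y \<in> orbit\<^sub>0 H" "z \<in> orbit\<^sub>0 H" "y \<noteq> z" "c = y \<bullet> z"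
      by blast
    obtain h where h: "h \<in> H" "c = x\<^sub>0 \<bullet> (x\<^sub>0 v* h)"
      using orbit_inner[OF yz(1,2)] yz(4) by blast
    obtain A q where Aq: "h = eps A ** perm_matrix q" "A \<in> RM 2" "0 \<notin> A" "q \<in> Q_group \<omega>\<^sub>1 B\<^sub>0"
      using decomp[OF h(1)] by blast
    have "A \<in> RM 1 \<or> defect A = 2"
      using defect Aq(2,4) h(1) Aq(1) by blast
    then show "c \<in> {0, 4, - 4}"
      using value_RM_1[OF Aq(1) _ Aq(3)] value_defect_2[OF Aq(1,2)] not_16[OF yz(1-3)] h(2) yz(4)
      by auto
  qed
  moreover have "0 \<in> ?D" and "4 \<in> ?D" and "- 4 \<in> ?D"
  proof -
    \<comment> \<open>The words of the elements of \<open>E_group \<omega>\<^sub>1\<close>, taken as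
      vectors so that they can be added and summed over.\<close>
    define W :: "(bit ^ \<Omega>) set" where "W = {F. {x. F $ x = 1} \<in> RM 1 \<and> F $ 0 = 0 \<and> F $ \<omega>\<^sub>1 = 0}"
    have word_supp: "word {x. F $ x = 1} = F" for F :: "bit ^ \<Omega>"
      by (auto simp: vec_eq_iff)
    have W_iff: "F \<in> W \<longleftrightarrow> F \<in> vec.span (word ` affine_subspaces 1) \<and> F $ 0 = 0 \<and> F $ \<omega>\<^sub>1 = 0" for F
      by (simp add: W_def RM_def word_supp)
    have W_add: "F + G \<in> W" if "F \<in> W" "G \<in> W" for F G
      using that by (simp add: W_iff vec.span_add)
    have "0 \<in> W"
      by (simp add: W_iff vec.span_zero)
    have eps_mem: "eps {x. F $ x = 1} \<in> H" if "F \<in> W" for F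
    proof -
      have "eps {x. F $ x = 1} \<in> E_group \<omega>\<^sub>1"
        using that unfolding W_def E_group_def by (intro CollectI exI[of _ "{x. F $ x = 1}"]) simp
      then show ?thesis
        using H(2) by blast
    qed
    have W_separates: "\<exists>F\<in>W. F $ \<omega> = 1" if \<omega>: "\<omega> \<noteq> 0" "\<omega> \<noteq> \<omega>\<^sub>1" for \<omega>
    proof -
      obtain A where "A \<in> RM 1" "0 \<notin> A" "\<omega>\<^sub>1 \<notin> A" "\<omega> \<in> A"
        using RM_1_separates[OF assms(1) \<omega>] by blast
      then show ?thesis
        by (intro bexI[of _ "word A"]) (simp_all add: W_def)
    qed
    \<comment> \<open>A pure sign change is thereby of the form
      \<open>eps A ** perm_matrix q\<close>, with \<open>q\<close> the identity.\<close>
    have "i v* mat 1 = i" for i :: \<Omega>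
      using vector_transpose_matrix[of i "mat 1"] by simp
    then have perm_1: "perm_matrix (mat 1) = mat 1"
      unfolding perm_matrix_def mat_def[where 'a = real] by (auto intro!: arg_cong[where f = vec_lambda] ext)

    show "0 \<in> ?D"
    proof -
      have "card {0, \<omega>\<^sub>1} < card (UNIV :: \<Omega> set)"
        using assms(1) by simp
      then have "{0, \<omega>\<^sub>1} \<noteq> UNIV"
        by (metis less_irrefl)
      then obtain \<omega> where "\<omega> \<noteq> 0" "\<omega> \<noteq> \<omega>\<^sub>1"
        by blast
      then obtain F where F: "F \<in> W" "F $ \<omega> = 1"
        using W_separates by blast
      then have "F \<noteq> 0"
        by auto
      then have "sign_sum F = 0"
        using sign_sum_affine(1)[of F] RM_1_is_affine[of "{x. F $ x = 1}"] F(1)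
        by (simp add: W_def word_supp)
      then have "x\<^sub>0 \<bullet> (x\<^sub>0 v* (eps {x. F $ x = 1} ** perm_matrix (mat 1))) = 0"
        by (simp only: inner_x\<^sub>0_eps_perm word_supp)
      then show ?thesis
        using witness[OF eps_mem[OF F(1)]] by (simp only: perm_1 matrix_mul_rid)
    qed

    have "\<exists>B q. eps B ** perm_matrix q \<in> H \<and> q \<in> Q_group \<omega>\<^sub>1 B\<^sub>0 \<and> B \<notin> RM 1"
    proof (rule ccontr)
      assume none: "\<not> ?thesis"
      have RM_1: "A \<in> RM 1" if "eps A ** perm_matrix q \<in> H" "q \<in> Q_group \<omega>\<^sub>1 B\<^sub>0" for A q
        using none that by blast
      have "y \<bullet> z = 0" if yz: "y \<in> orbit\<^sub>0 H" "z \<in> orbit\<^sub>0 H" "y \<noteq> z" for y z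
      proof -
        obtain h where h: "h \<in> H" "y \<bullet> z = x\<^sub>0 \<bullet> (x\<^sub>0 v* h)"
          using orbit_inner[OF yz(1,2)] by blast
        obtain A q where Aq: "h = eps A ** perm_matrix q" "0 \<notin> A" "q \<in> Q_group \<omega>\<^sub>1 B\<^sub>0"
          using decomp[OF h(1)] by blast
        then show ?thesis
          using value_RM_1[OF Aq(1) _ Aq(2)] RM_1[of A q] h not_16[OF yz] by auto
      qed
      \<comment> \<open>Nonzero pairwise orthogonal vectors are independent, so there are at most 16
        of them, not 64.\<close>
      then have "pairwise orthogonal (orbit\<^sub>0 H)"
        by (simp add: pairwise_def orthogonal_def)
      moreover have "0 \<notin> orbit\<^sub>0 H"
        using norm by fastforce
      ultimately have "card (orbit\<^sub>0 H) \<le> DIM(V)"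
        using pairwise_orthogonal_independent independent_bound by blast
      then show False
        using card by simp
    qed
    then obtain B q where B: "eps B ** perm_matrix q \<in> H" "q \<in> Q_group \<omega>\<^sub>1 B\<^sub>0" "B \<notin> RM 1"
      by blast

    \<comment> \<open>Multiplying by elements of \<open>E_group \<omega>\<^sub>1\<close> runs
      through the coset of \<open>word B\<close> modulo \<open>W\<close> with \<open>q\<close>
      fixed.\<close>
    have sum_mem: "eps {x. (F + word B) $ x = 1} ** perm_matrix q \<in> H" if "F \<in> W" for F
    proof -
      have "eps {x. F $ x = 1} ** (eps B ** perm_matrix q) \<in> H"
        using mult_mem eps_mem[OF that] B(1) by blast
      moreover have "eps {x. F $ x = 1} ** (eps B ** perm_matrix q) =
          eps {x. (F + word B) $ x = 1} ** perm_matrix q"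
        by (rule eps_mult_eps) (simp only: word_supp)
      ultimately show ?thesis
        by simp
    qed
    have value_sum: "sign_sum (F + word B) \<in> {4, - 4}" if "F \<in> W" for F
    proof -
      let ?A = "{x. (F + word B) $ x = 1}"
      have "?A \<notin> RM 1"
      proof
        assume "?A \<in> RM 1"
        \<comment> \<open>Adding \<open>F\<close> again returns \<open>word B\<close>, which would
          then be a word of \<open>RM 1\<close>.\<close>
        then have "F + (F + word B) \<in> vec.span (word ` affine_subspaces 1)"
          using that W_iff unfolding RM_def mem_Collect_eq word_supp by (blast intro: vec.span_add)
        then show False
          using B(3) by (simp add: RM_def)
      qed
      moreover have "?A \<in> RM 2"
        using RM_2[OF sum_mem[OF that]] by blast
      ultimately have "defect ?A = 2"
        using defect B(2) sum_mem[OF that] by blast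
      then show ?thesis
        using sign_sum_defect_2[OF \<open>?A \<in> RM 2\<close>] by (simp only: word_supp)
    qed
    have total: "(\<Sum>F\<in>W. sign_sum (F + word B)) = 2 * real (card W)"
    proof -
      have "(\<Sum>F\<in>W. sign_sum (F + word B)) =
          (\<Sum>F\<in>W. \<Sum>x\<in>UNIV. bit_sign (word B $ x) * bit_sign (F $ x))"
        by (simp only: sign_sum_def vector_add_component bit_sign_add mult.commute)
      also have "\<dots> = (\<Sum>x\<in>UNIV. bit_sign (word B $ x) * (\<Sum>F\<in>W. bit_sign (F $ x)))"
        unfolding sum_distrib_left by (rule sum.swap)
      \<comment> \<open>Any other point is separated by some word of \<open>W\<close>, so its inner
        sum vanishes. At these two points all words involved are 0, and each contributes
        \<open>card W\<close>.\<close>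
      also have "\<dots> = (\<Sum>x\<in>{0, \<omega>\<^sub>1}. bit_sign (word B $ x) * (\<Sum>F\<in>W. bit_sign (F $ x)))"
        using W_separates sum_sign_words[OF W_add] by (intro sum.mono_neutral_right) auto
      also have "\<dots> = (\<Sum>x\<in>{0, \<omega>\<^sub>1}. real (card W))"
        using RM_2[OF B(1)] by (intro sum.cong refl) (auto simp: W_def)
      also have "\<dots> = 2 * real (card W)"
        using assms(1) by simp
      finally show ?thesis .
    qed
    have "card W > 0"
      using \<open>0 \<in> W\<close> by (auto simp: card_gt_0_iff)
    have attained: "c \<in> ?D" if c: "c \<in> {4, - 4}" for c
    proof (rule ccontr)
      assume "c \<notin> ?D"
      have "sign_sum (F + word B) = - c" if "F \<in> W" for F
      proof -
        have "sign_sum (F + word B) \<noteq> c"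
        proof
          assume "sign_sum (F + word B) = c"
          then have "x\<^sub>0 \<bullet> (x\<^sub>0 v* (eps {x. (F + word B) $ x = 1} ** perm_matrix q)) = c"
            by (simp only: inner_x\<^sub>0_eps_perm word_supp)
          moreover have "c \<noteq> 16"
            using c by auto
          ultimately show False
            using witness[OF sum_mem[OF that]] \<open>c \<notin> ?D\<close> by blast
        qed
        then show ?thesis
          using value_sum[OF that] c by auto
      qed
      \<comment> \<open>A single value throughout would make the average 4 or -4 instead of
        2.\<close>
      then have "(\<Sum>F\<in>W. sign_sum (F + word B)) = - c * real (card W)"
        by simp
      then show False
        using total c \<open>card W > 0\<close> by auto
    qed
    show "4 \<in> ?D" "- 4 \<in> ?D"
      by (rule attained; simp)+
  qed
  ultimately show "?D = {0, 4, - 4}"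
    by blast
qed

section \<open>The three codes\<close>

theorem theorem4p11:
  fixes \<omega>\<^sub>1 :: \<Omega> and B\<^sub>0 :: "\<Omega> set" and H :: "(real ^ \<Omega> ^ \<Omega>) set"
  assumes "\<omega>\<^sub>1 \<noteq> 0"
    and "vec.subspace B\<^sub>0" and "vec.dim B\<^sub>0 = 3" and "\<omega>\<^sub>1 \<notin> B\<^sub>0"
    and "H \<in> \<G> \<omega>\<^sub>1 B\<^sub>0"
    and "\<And>A q. \<lbrakk>A \<in> RM 2; q \<in> Q_group \<omega>\<^sub>1 B\<^sub>0; eps A ** perm_matrix q \<in> H\<rbrakk>
           \<Longrightarrow> A \<in> RM 1 \<or> defect A = 2"
    and "card (orbit\<^sub>0 H) = 64"
  shows "(let C = (\<lambda>x. (1/4) *\<^sub>R x) ` orbit\<^sub>0 H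
          in spherical_code C \<and> cosine_set C = {0, 1/4, - (1/4)}) \<and>
         (let W = {axis \<omega>\<^sub>0 1}\<^sup>\<bottom> :: V set; C = projected_code W (orbit\<^sub>0 H)
          in dim W = 15 \<and> C \<subseteq> W \<and> spherical_code C \<and>
             cosine_set C = {- (1/3), - (1/15), 1/5}) \<and>
         (let W = (span {axis \<omega>\<^sub>0 1, axis \<omega>\<^sub>1 1})\<^sup>\<bottom> :: V set; C = projected_code W (orbit\<^sub>0 H)
          in dim W = 14 \<and> C \<subseteq> W \<and> spherical_code C \<and>
             cosine_set C = {- (3/7), - (1/7), 1/7})"
proof -
  let ?X = "orbit\<^sub>0 H" and ?P = "{y \<bullet> z | y z. y \<in> orbit\<^sub>0 H \<and> z \<in> orbit\<^sub>0 H \<and> y \<noteq> z}"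
  have "\<forall>A\<in>RM 2. \<forall>q\<in>Q_group \<omega>\<^sub>1 B\<^sub>0. eps A ** perm_matrix q \<in> H \<longrightarrow> A \<in> RM 1 \<or> defect A = 2"
    using assms(6) by blast
  note orbit = inner_products_orbit[OF assms(1,5) this assms(7)]
  have "spherical_code ((\<lambda>x. (1/4) *\<^sub>R x) ` ?X)"
    using orbit(1,3) by (auto simp: spherical_code_def norm_eq_sqrt_inner)
  moreover have "cosine_set ((\<lambda>x. (1/4) *\<^sub>R x) ` ?X) = {0, 1/4, - (1/4)}"
  proof -
    have "cosine_set ((\<lambda>x. (1/4) *\<^sub>R x) ` ?X) = (\<lambda>c. c / 16) ` ?P"
    proof (intro subset_antisym subsetI)
      fix c
      assume "c \<in> cosine_set ((\<lambda>x. (1/4) *\<^sub>R x) ` ?X)"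
      then obtain y z where "y \<in> ?X" "z \<in> ?X" "y \<noteq> z" "c = (y \<bullet> z) / 16"
        by (auto simp: cosine_set_def)
      then show "c \<in> (\<lambda>c. c / 16) ` ?P"
        by blast
    next
      fix c
      assume "c \<in> (\<lambda>c. c / 16) ` ?P"
      then obtain y z where "y \<in> ?X" "z \<in> ?X" "y \<noteq> z"
        and "c = ((1/4) *\<^sub>R y) \<bullet> ((1/4) *\<^sub>R z)" "(1/4) *\<^sub>R y \<noteq> (1/4) *\<^sub>R z"
        by auto
      then show "c \<in> cosine_set ((\<lambda>x. (1/4) *\<^sub>R x) ` ?X)"
        unfolding cosine_set_def by blast
    qed
    then show ?thesis
      by (simp add: orbit(4))
  qed
  moreover have "let W = {axis \<omega>\<^sub>0 1}\<^sup>\<bottom> :: V set; C = projected_code W ?X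
      in dim W = 15 \<and> C \<subseteq> W \<and> spherical_code C \<and> cosine_set C = {- (1/3), - (1/15), 1/5}"
  proof -
    have W: "{axis \<omega>\<^sub>0 1}\<^sup>\<bottom> = {x :: V. \<forall>i\<in>{0}. x $ i = 0}"
      by (auto simp: orthogonal_comp_def orthogonal_def inner_axis')
    have "i \<in> {0} \<Longrightarrow> y $ i = 1" if "y \<in> ?X" for y and i :: \<Omega>
      using orbit(2)[OF that] by auto
    \<comment> \<open>The inner products 0, 4, -4 become (c - 1) / 15.\<close>
    note code = coordinate_code[where S = "{0}" and N = 16, OF orbit(1) this orbit(3)]
    show ?thesis
      unfolding Let_def W using code by (simp add: orbit(4) insert_commute)
  qed
  moreover have "let W = (span {axis \<omega>\<^sub>0 1, axis \<omega>\<^sub>1 1})\<^sup>\<bottom> :: V set; C = projected_code W ?X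
      in dim W = 14 \<and> C \<subseteq> W \<and> spherical_code C \<and> cosine_set C = {- (3/7), - (1/7), 1/7}"
  proof -
    have W: "(span {axis \<omega>\<^sub>0 1, axis \<omega>\<^sub>1 1})\<^sup>\<bottom> = {x :: V. \<forall>i\<in>{0, \<omega>\<^sub>1}. x $ i = 0}"
      using orthogonal_comp_axes[of "{0, \<omega>\<^sub>1}"] by simp
    have card: "card {0, \<omega>\<^sub>1} = 2"
      using assms(1) by simp
    have "i \<in> {0, \<omega>\<^sub>1} \<Longrightarrow> y $ i = 1" if "y \<in> ?X" for y i
      using orbit(2)[OF that] by auto
    \<comment> \<open>With two coordinates removed the cosines are (c - 2) / 14.\<close>
    note code = coordinate_code[where S = "{0, \<omega>\<^sub>1}" and N = 16, OF orbit(1) this orbit(3), unfolded card]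
    show ?thesis
      unfolding Let_def W using code by (simp add: orbit(4) insert_commute)
  qed
  ultimately show ?thesis
    unfolding Let_def by blast
qed

end
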